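(* Let $a,b,c,d$ be positive real numbers with $\min\{c,d\}>\max\{a,b\}$, and let $\{P_n(x;a,b;c,d)\}_{n\in\mathbb{N}}$ be the monic $2$-orthogonal polynomial sequence with respect to the weight vector $\overline{\mathcal{W}}(x;a,b;c,d)$. Then $$\lim_{n\to\infty}\frac{(-1)^n\left(c+\left\lfloor\frac n2\right\rfloor\right)_n\left(d+\left\lfloor\frac{n-1}2\right\rfloor\right)_n}{(a)_n(b)_n}\,P_n\!\left(\frac{z}{n^3};a,b;c,d\right)={}_0F_2\!\left(\begin{matrix}-\\ a,b\end{matrix};-\frac z4\right)$$ uniformly for $z$ in compact subsets of $\mathbb{C}$.
   Context: $\mathbb{N}=\{0,1,2,\dots\}$; $(z)_0=1$ and $(z)_n=z(z+1)\cdots(z+n-1)$. ${}_0F_2(-;a,b;z)=\sum_{j\ge0}\frac{1}{(a)_j(b)_j}\frac{z^j}{j!}$ and ${}_2F_1(\alpha,\beta;\gamma;z)=\sum_{j\ge0}\frac{(\alpha)_j(\beta)_j}{(\gamma)_j}\frac{z^j}{j!}$ for $|z|<1$. For positive reals $a,b,c,d$ with $\delta:=c+d-a-b>0$, the function $\mathcal{W}(\cdot\,;a,b;c,d)$ on $(0,1)$ is $$\mathcal{W}(x;a,b;c,d)=\frac{\Gamma(c)\Gamma(d)}{\Gamma(a)\Gamma(b)\Gamma(\delta)}\,x^{a-1}(1-x)^{\delta-1}\,{}_2F_1(c-b,d-b;\delta;1-x).$$ (The condition $\min\{c,d\}>\max\{a,b\}$ implies $\delta>0$.) The weight vector $\overline{\mathcal{W}}(x;a,b;c,d)$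 has components $w_0(x)=\mathcal{W}(x;a,b;c,d)$ and $w_1(x)=\mathcal{W}(x;a,b+1;c+1,d)$. A sequence of monic polynomials $\{P_n\}_{n\in\mathbb{N}}$ with $\deg P_n=n$ is the monic $2$-orthogonal polynomial sequence with respect to $\overline{\mathcal{W}}(x;a,b;c,d)$ if, for each $j\in\{0,1\}$ and $k,n\in\mathbb{N}$, $\int_0^1x^kP_n(x)w_j(x)\,\mathrm{d}x$ equals $0$ if $n\ge 2k+j+1$ and is nonzero if $n=2k+j$. For these weights it exists and is unique. *)

theory Defs
  imports "HOL-Analysis.Analysis" "HOL-Computational_Algebra.Polynomial"
begin

definition hyp_0F2 :: "complex \<Rightarrow> complex \<Rightarrow> complex \<Rightarrow> complex" where
  "hyp_0F2 a b z = (\<Sum>j. 1 / (pochhammer a j * pochhammer b j) * (z ^ j / fact j))"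

text \<open>Meaningful for \<open>\<bar>z\<bar> < 1\<close> and \<open>\<gamma>\<close> not a non-positive integer, where the series converges.\<close>

definition hyp_2F1 :: "real \<Rightarrow> real \<Rightarrow> real \<Rightarrow> real \<Rightarrow> real" where
  "hyp_2F1 \<alpha> \<beta> \<gamma> z =
     (\<Sum>j. pochhammer \<alpha> j * pochhammer \<beta> j / pochhammer \<gamma> j * (z ^ j / fact j))"

text \<open>Only used for \<open>0 < x < 1\<close>, positive parameters and \<open>c + d - a - b > 0\<close>.\<close>

definition weight_W :: "real \<Rightarrow> real \<Rightarrow> real \<Rightarrow> real \<Rightarrow> real \<Rightarrow> real" where
  "weight_W a b c d x =
     (let \<delta> = c + d - a - b in
        Gamma c * Gamma d / (Gamma a * Gamma b * Gamma \<delta>)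
        * x powr (a - 1) * (1 - x) powr (\<delta> - 1)
        * hyp_2F1 (c - b) (d - b) \<delta> (1 - x))"

definition weight_vec :: "real \<Rightarrow> real \<Rightarrow> real \<Rightarrow> real \<Rightarrow> nat \<Rightarrow> real \<Rightarrow> real" where
  "weight_vec a b c d j =
     (if j = 0 then weight_W a b c d else weight_W a (b + 1) (c + 1) d)"

text \<open>
  The polynomials are allowed complex coefficients, which includes the real ones.
\<close>

definition monic_2_orthogonal ::
  "(nat \<Rightarrow> real \<Rightarrow> real) \<Rightarrow> (nat \<Rightarrow> complex poly) \<Rightarrow> bool" where
  "monic_2_orthogonal w P \<longleftrightarrow>
     (\<forall>n. degree (P n) = n \<and> lead_coeff (P n) = 1) \<and>
     (\<forall>j\<in>{0, 1}. \<forall>k n.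
        (let I = (LINT x:{0<..<1}|lborel.
                    complex_of_real x ^ k * poly (P n) (complex_of_real x)
                    * complex_of_real (w j x))
         in (n \<ge> 2 * k + j + 1 \<longrightarrow> I = 0) \<and> (n = 2 * k + j \<longrightarrow> I \<noteq> 0)))"

end

theory Submission
  imports Defs "HOL-Real_Asymp.Real_Asymp"
begin

text \<open>
  Integrating the series of \<open>\<W>\<close> termwise and summing with Gauss's theorem gives the moments
  \<open>(a)\<^sub>m (b)\<^sub>m / ((c)\<^sub>m (d)\<^sub>m)\<close>. Against these, orthogonality of
  \<open>\<^sub>3F\<^sub>2(-n, c + \<lfloor>n/2\<rfloor>, d + \<lfloor>(n-1)/2\<rfloor>; a, b; x)\<close> says that the \<open>n\<close>-th difference of a polynomial of
  degree \<open>n - 1\<close> vanishes. The nonvanishing half of \<open>2\<close>-orthogonality makes the functionals triangular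
  on \<open>P\<close>, so \<open>P n\<close> is this polynomial up to the stated factor. The limit is then taken termwise by
  Tannery's theorem.
\<close>

section \<open>Beta integrals, termwise integration and Gauss's summation theorem\<close>

lemma pochhammer_Gamma_real:
  fixes x :: real
  assumes "x > 0"
  shows "pochhammer x n = Gamma (x + of_nat n) / Gamma x"
  using assms by (intro pochhammer_Gamma) auto

lemma Beta_plus_of_nat_left:
  fixes p q :: real
  assumes "p > 0" "q > 0"
  shows "Beta (p + of_nat j) q = Beta p q * pochhammer p j / pochhammer (p + q) j"
proof -
  have "Gamma p \<noteq> 0" "Gamma (p + q) \<noteq> 0" "Gamma (p + (q + of_nat j)) \<noteq> 0"
    using assms by (auto simp: Gamma_real_pos less_imp_neq[symmetric] add_pos_nonneg)
  then show ?thesis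
    using assms
    by (simp add: Beta_def pochhammer_Gamma_real add_ac)
qed

lemma has_bochner_integral_Beta:
  fixes p q :: real
  assumes "p > 0" "q > 0"
  shows "has_bochner_integral lborel
    (\<lambda>x. indicator {0<..<1} x * (x powr (p - 1) * (1 - x) powr (q - 1))) (Beta p q)"
proof -
  let ?f = "\<lambda>x::real. x powr (p - 1) * (1 - x) powr (q - 1)"
  have si: "set_integrable lborel {0..1} ?f"
    using integrable_Beta[OF assms] .
  have "(LINT x:{0..1}|lborel. ?f x) = Beta p q"
    using set_borel_integral_eq_integral(2)[OF si] has_integral_Beta_real[OF assms]
    by (simp add: integral_unique)
  then have "has_bochner_integral lborel (\<lambda>x. indicator {0..1} x * ?f x) (Beta p q)"
    using si by (simp add: has_bochner_integral_iff set_integrable_def set_lebesgue_integral_def)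
  \<comment> \<open>At both endpoints the integrand is 0 whatever the exponent, because
    \<open>0 powr y = 0\<close> for every \<open>y\<close>.\<close>
  moreover have "indicator {0..1} x * ?f x = indicator {0<..<1} x * ?f x" for x
    by (cases "x = 0 \<or> x = 1") (auto simp: indicator_def)
  ultimately show ?thesis by simp
qed

text \<open>From index 1 on the terms share the sign \<open>s\<close>, so a nonempty partial sum
  differs from \<open>f 0\<close> by at most \<open>\<bar>F - f 0\<bar>\<close>; this gives an
  integrable majorant for dominated convergence. Term 0 is exempt because in the applications it is
  positive even when \<open>s = -1\<close>.\<close>

lemma has_bochner_integral_sums_of_sign:
  fixes f :: "nat \<Rightarrow> 'a \<Rightarrow> real"
  assumes f: "\<And>j. has_bochner_integral M (f j) (v j)"
    and F: "has_bochner_integral M F I"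
    and sums: "AE x in M. (\<lambda>j. f j x) sums F x"
    and sgn: "AE x in M. \<forall>j\<ge>1. 0 \<le> s * f j x" and s: "s = 1 \<or> s = -1"
  shows "v sums I"
proof -
  have int: "integrable M (f j)" "integrable M F" for j
    using f F by (auto simp: has_bochner_integral_iff)
  have "(\<lambda>n. LINT x|M. (\<Sum>j<n. f j x)) \<longlonglongrightarrow> (LINT x|M. F x)"
  proof (rule integral_dominated_convergence[where w = "\<lambda>x. \<bar>f 0 x\<bar> + \<bar>F x - f 0 x\<bar>"])
    show "AE x in M. (\<lambda>n. \<Sum>j<n. f j x) \<longlonglongrightarrow> F x"
      using sums by eventually_elim (simp add: sums_def)
    show "AE x in M. norm (\<Sum>j<n. f j x) \<le> \<bar>f 0 x\<bar> + \<bar>F x - f 0 x\<bar>" for n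
      using sums sgn
    proof eventually_elim
      case (elim x)
      have sm: "(\<lambda>j. s * f (Suc j) x) sums (s * (F x - f 0 x))"
        using elim(1) by (intro sums_mult, subst sums_Suc_iff) simp
      show ?case
      proof (cases n)
        case (Suc k)
        have le: "(\<Sum>j<k. s * f (Suc j) x) \<le> s * (F x - f 0 x)"
          using sum_le_suminf[OF sums_summable[OF sm], of "{..<k}"] elim(2) sums_unique[OF sm]
          by simp
        have ge: "0 \<le> (\<Sum>j<k. s * f (Suc j) x)"
          using elim(2) by (intro sum_nonneg) simp
        have "\<bar>\<Sum>j<k. f (Suc j) x\<bar> = \<bar>\<Sum>j<k. s * f (Suc j) x\<bar>"
          using s by (auto simp flip: sum_distrib_left)
        also have "\<dots> \<le> \<bar>F x - f 0 x\<bar>"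
          using le ge s by auto
        finally show ?thesis
          using Suc by (simp add: sum.lessThan_Suc_shift del: sum.lessThan_Suc)
      qed simp
    qed
  qed (use int in \<open>auto intro!: Bochner_Integration.integrable_add integrable_abs Bochner_Integration.integrable_diff borel_measurable_integrable\<close>)
  moreover have "(LINT x|M. (\<Sum>j<n. f j x)) = (\<Sum>j<n. v j)" for n
    using f by (intro has_bochner_integral_integral_eq has_bochner_integral_sum) simp_all
  moreover have "(LINT x|M. F x) = I"
    using F by (rule has_bochner_integral_integral_eq)
  ultimately show ?thesis
    by (simp add: sums_def)
qed

lemma powr_add_of_nat_minus_1:
  fixes x :: real
  assumes "x > 0"
  shows "x powr (y + of_nat j - 1) = x powr (y - 1) * x ^ j"
  using assms by (simp add: powr_add powr_diff powr_realpow)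

text \<open>For \<open>-1 < \<alpha> < 0\<close> the leading factor \<open>\<alpha>\<close> is the
  only negative one. The empty product at \<open>j = 0\<close> lacks it, hence
  \<open>j \<ge> 1\<close>.\<close>

lemma pochhammer_sign:
  fixes \<alpha> :: real
  assumes "\<alpha> > -1" "j \<ge> 1"
  shows "0 \<le> (if \<alpha> \<ge> 0 then 1 else - 1) * pochhammer \<alpha> j"
proof -
  obtain k where k: "j = Suc k" using assms by (cases j) auto
  have "pochhammer (\<alpha> + 1) k > 0"
    using assms by (intro pochhammer_pos) auto
  then show ?thesis
    by (auto simp: k pochhammer_rec zero_le_mult_iff mult_nonpos_nonneg)
qed

text \<open>
  Gauss's theorem. Integrating the binomial series of \<open>(1 - t) powr (- \<alpha>)\<close> termwise against a Beta
  density is justified because all terms but the first have the same sign when \<open>\<alpha> > -1\<close>.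
\<close>

lemma Gauss_2F1_sums:
  fixes \<alpha> \<beta> \<gamma> :: real
  assumes "\<alpha> > -1" "\<beta> > 0" "\<gamma> > \<beta>" "\<gamma> - \<alpha> - \<beta> > 0"
  shows "(\<lambda>j. pochhammer \<beta> j * pochhammer \<alpha> j / (pochhammer \<gamma> j * fact j)) sums
           (Gamma \<gamma> * Gamma (\<gamma> - \<alpha> - \<beta>) / (Gamma (\<gamma> - \<alpha>) * Gamma (\<gamma> - \<beta>)))" (is "?v sums ?G")
proof -
  define s :: real where "s = (if \<alpha> \<ge> 0 then 1 else - 1)"
  define f where "f = (\<lambda>j x. pochhammer \<alpha> j / fact j *
    (indicator {0<..<1} x * (x powr (\<beta> + of_nat j - 1) * (1 - x) powr (\<gamma> - \<beta> - 1))) :: real)"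
  \<comment> \<open>The binomial sum \<open>(1 - x) powr (-\<alpha>)\<close> is absorbed into the
    density, so \<open>F\<close> is again a Beta integrand, with second parameter
    \<open>\<gamma> - \<alpha> - \<beta>\<close> in place of
    \<open>\<gamma> - \<beta>\<close>.\<close>
  define F where "F = (\<lambda>x::real. indicator {0<..<1} x *
    (x powr (\<beta> - 1) * (1 - x) powr (\<gamma> - \<alpha> - \<beta> - 1)))"
  have B: "Beta \<beta> (\<gamma> - \<beta>) > 0"
    using assms by (simp add: Beta_def)
  have "(\<lambda>j. pochhammer \<alpha> j / fact j * Beta (\<beta> + of_nat j) (\<gamma> - \<beta>)) sums Beta \<beta> (\<gamma> - \<alpha> - \<beta>)"
  proof (rule has_bochner_integral_sums_of_sign[where f = f and F = F and M = lborel and s = s])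
    show "has_bochner_integral lborel (f j) (pochhammer \<alpha> j / fact j * Beta (\<beta> + of_nat j) (\<gamma> - \<beta>))" for j
      unfolding f_def using assms
      by (intro has_bochner_integral_mult_right has_bochner_integral_Beta) auto
    show "has_bochner_integral lborel F (Beta \<beta> (\<gamma> - \<alpha> - \<beta>))"
      unfolding F_def using assms by (intro has_bochner_integral_Beta) auto
    show "AE x in lborel. (\<lambda>j. f j x) sums F x"
    proof (rule AE_I2)
      fix x :: real
      show "(\<lambda>j. f j x) sums F x"
      proof (cases "x \<in> {0<..<1}")
        case True
        have "(\<lambda>n. ((-\<alpha>) gchoose n) * (-x)^n) sums (1 + (-x)) powr (-\<alpha>)"
          using True by (intro gen_binomial_real) auto
        moreover have "((-\<alpha>) gchoose n) * (-x)^n = pochhammer \<alpha> n / fact n * x ^ n" for n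
          by (cases "even n") (simp_all add: gbinomial_pochhammer)
        ultimately have "(\<lambda>n. pochhammer \<alpha> n / fact n * x ^ n) sums (1 - x) powr (-\<alpha>)"
          by simp
        then have "(\<lambda>n. x powr (\<beta> - 1) * (1 - x) powr (\<gamma> - \<beta> - 1) * (pochhammer \<alpha> n / fact n * x ^ n))
            sums (x powr (\<beta> - 1) * (1 - x) powr (\<gamma> - \<beta> - 1) * (1 - x) powr (-\<alpha>))"
          by (rule sums_mult)
        moreover have "x powr (\<beta> - 1) * (1 - x) powr (\<gamma> - \<beta> - 1) * (pochhammer \<alpha> n / fact n * x ^ n) = f n x" for n
        proof -
          have "x powr (\<beta> + real n - 1) = x powr (\<beta> - 1) * x ^ n"
            using True by (simp add: powr_add_of_nat_minus_1)
          then show ?thesis using True by (simp add: f_def)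
        qed
        moreover have "x powr (\<beta> - 1) * (1 - x) powr (\<gamma> - \<beta> - 1) * (1 - x) powr (-\<alpha>) = F x"
          using True by (simp add: F_def mult.assoc algebra_simps flip: powr_add)
        ultimately show ?thesis by simp
      qed (simp_all add: f_def F_def)
    qed
    show "AE x in lborel. \<forall>j\<ge>1. 0 \<le> s * f j x"
    proof (intro AE_I2 allI impI)
      fix x :: real and j :: nat assume "j \<ge> 1"
      then have "0 \<le> s * pochhammer \<alpha> j"
        unfolding s_def by (rule pochhammer_sign[OF assms(1)])
      then have "0 \<le> (s * pochhammer \<alpha> j) * (indicator {0<..<1} x *
          (x powr (\<beta> + of_nat j - 1) * (1 - x) powr (\<gamma> - \<beta> - 1)) / fact j)"
        by (rule mult_nonneg_nonneg) auto
      then show "0 \<le> s * f j x" by (simp add: f_def mult_ac)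
    qed
  qed (auto simp: s_def)
  then have "(\<lambda>j. pochhammer \<alpha> j / fact j * Beta (\<beta> + of_nat j) (\<gamma> - \<beta>) / Beta \<beta> (\<gamma> - \<beta>))
      sums (Beta \<beta> (\<gamma> - \<alpha> - \<beta>) / Beta \<beta> (\<gamma> - \<beta>))"
    by (rule sums_divide)
  also have "(\<lambda>j. pochhammer \<alpha> j / fact j * Beta (\<beta> + of_nat j) (\<gamma> - \<beta>) / Beta \<beta> (\<gamma> - \<beta>)) = ?v"
    using assms B by (auto simp: fun_eq_iff Beta_plus_of_nat_left mult_ac)
  also have "Beta \<beta> (\<gamma> - \<alpha> - \<beta>) / Beta \<beta> (\<gamma> - \<beta>) = ?G"
  proof -
    have "Gamma \<beta> > 0" using assms by simp
    then show ?thesis by (simp add: Beta_def field_simps)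
  qed
  finally show ?thesis .
qed

section \<open>Moments of the hypergeometric weights\<close>

text \<open>Ratio test: the ratios tend to \<open>\<bar>y\<bar>\<close>, and
  \<open>(1 + \<bar>y\<bar>) / 2\<close> is the midpoint between that limit and 1. If
  \<open>pochhammer \<gamma>\<close> vanishes, division by zero makes the terms 0 and the recurrence
  between them persists.\<close>

lemma summable_hyp_2F1_norm:
  fixes \<alpha> \<beta> \<gamma> y :: real
  assumes "\<bar>y\<bar> < 1"
  shows "summable (\<lambda>j. \<bar>pochhammer \<alpha> j * pochhammer \<beta> j / pochhammer \<gamma> j * (y ^ j / fact j)\<bar>)"
proof -
  have "(\<lambda>n. \<bar>(\<alpha> + real n) * (\<beta> + real n) / ((\<gamma> + real n) * (1 + real n))\<bar> * \<bar>y\<bar>) \<longlonglongrightarrow> 1 * \<bar>y\<bar>"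
    by (intro tendsto_mult_right, real_asymp)
  then have "eventually (\<lambda>n. \<bar>(\<alpha> + real n) * (\<beta> + real n) / ((\<gamma> + real n) * (1 + real n))\<bar> * \<bar>y\<bar> < (1 + \<bar>y\<bar>) / 2) sequentially"
    using assms by (intro order_tendstoD(2)) auto
  then obtain N where N: "\<And>n. n \<ge> N \<Longrightarrow> \<bar>(\<alpha> + real n) * (\<beta> + real n) / ((\<gamma> + real n) * (1 + real n))\<bar> * \<bar>y\<bar> \<le> (1 + \<bar>y\<bar>) / 2"
    by (auto simp: eventually_sequentially intro: less_imp_le)
  show ?thesis
  proof (rule summable_ratio_test[where c = "(1 + \<bar>y\<bar>) / 2" and N = N])
    fix n assume n: "n \<ge> N"
    let ?t = "\<bar>pochhammer \<alpha> n * pochhammer \<beta> n / pochhammer \<gamma> n * (y ^ n / fact n)\<bar>"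
    have "\<bar>pochhammer \<alpha> (Suc n) * pochhammer \<beta> (Suc n) / pochhammer \<gamma> (Suc n) * (y ^ Suc n / fact (Suc n))\<bar>
       = \<bar>(\<alpha> + real n) * (\<beta> + real n) / ((\<gamma> + real n) * (1 + real n))\<bar> * \<bar>y\<bar> * ?t"
      by (simp add: pochhammer_Suc abs_mult mult_ac add_ac)
    also have "\<dots> \<le> (1 + \<bar>y\<bar>) / 2 * ?t"
      using N[OF n] by (intro mult_right_mono) auto
    finally show "norm \<bar>pochhammer \<alpha> (Suc n) * pochhammer \<beta> (Suc n) / pochhammer \<gamma> (Suc n) * (y ^ Suc n / fact (Suc n))\<bar>
       \<le> (1 + \<bar>y\<bar>) / 2 * norm ?t" by simp
  qed (use assms in auto)
qed

text \<open>Expanding in powers of \<open>1 - x\<close> turns each term into a Beta integral, and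
  the resulting series is Gauss's with \<open>\<gamma> = p + \<delta>\<close>. The interchange needs
  absolute convergence of the integrated series, which again comes from the constant sign of the
  terms after the first.\<close>

lemma has_bochner_integral_hyp_2F1:
  fixes \<alpha> \<beta> \<delta> p :: real
  assumes "\<alpha> > -1" "\<beta> > 0" "\<delta> > 0" "p > 0" "p + \<delta> > \<beta>" "p + \<delta> - \<alpha> - \<beta> > 0"
  shows "has_bochner_integral lborel
    (\<lambda>x. indicator {0<..<1} x * (x powr (p - 1) * (1 - x) powr (\<delta> - 1) * hyp_2F1 \<beta> \<alpha> \<delta> (1 - x)))
    (Gamma p * Gamma \<delta> * Gamma (p + \<delta> - \<alpha> - \<beta>) / (Gamma (p + \<delta> - \<alpha>) * Gamma (p + \<delta> - \<beta>)))"
proof -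
  define c where "c = (\<lambda>j. pochhammer \<beta> j * pochhammer \<alpha> j / (pochhammer \<delta> j * fact j))"
  define B where "B = (\<lambda>j x. indicator {0<..<1} x *
    (x powr (p - 1) * (1 - x) powr (\<delta> + of_nat j - 1)) :: real)"
  have B: "has_bochner_integral lborel (B j) (Beta p (\<delta> + of_nat j))" for j
    unfolding B_def using assms by (intro has_bochner_integral_Beta) auto
  have Bnn: "B j x \<ge> 0" for j x by (auto simp: B_def indicator_def)
  have Beta: "Beta p (\<delta> + of_nat j) = Beta p \<delta> * pochhammer \<delta> j / pochhammer (p + \<delta>) j" for j
    using Beta_plus_of_nat_left[of \<delta> p j] assms by (simp add: Beta_commute add.commute)
  \<comment> \<open>The factor \<open>pochhammer \<delta> j\<close> from the Beta function cancels
    the denominator of the \<open>2F1\<close> coefficient;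
    \<open>pochhammer (p + \<delta>) j\<close> takes its place.\<close>
  have cB: "c j * Beta p (\<delta> + of_nat j) =
      Beta p \<delta> * (pochhammer \<beta> j * pochhammer \<alpha> j / (pochhammer (p + \<delta>) j * fact j))" for j
    using pochhammer_pos[OF \<open>\<delta> > 0\<close>, of j] by (simp add: c_def Beta mult_ac)
  let ?G = "Gamma (p + \<delta>) * Gamma (p + \<delta> - \<alpha> - \<beta>) / (Gamma (p + \<delta> - \<alpha>) * Gamma (p + \<delta> - \<beta>))"
  have sums: "(\<lambda>j. c j * Beta p (\<delta> + of_nat j)) sums (Beta p \<delta> * ?G)"
    unfolding cB using assms by (intro sums_mult Gauss_2F1_sums) auto
  have int: "integrable lborel (\<lambda>x. c j * B j x)"
    and val: "(LINT x|lborel. c j * B j x) = c j * Beta p (\<delta> + of_nat j)"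
    and valn: "(LINT x|lborel. norm (c j * B j x)) = \<bar>c j * Beta p (\<delta> + of_nat j)\<bar>" for j
  proof -
    show "integrable lborel (\<lambda>x. c j * B j x)" "(LINT x|lborel. c j * B j x) = c j * Beta p (\<delta> + of_nat j)"
      using B[of j] by (auto simp: has_bochner_integral_iff)
    have "(LINT x|lborel. norm (c j * B j x)) = (LINT x|lborel. \<bar>c j\<bar> * B j x)"
      using Bnn by (simp add: abs_mult)
    also have "\<dots> = \<bar>c j\<bar> * Beta p (\<delta> + of_nat j)"
      using B[of j] by (auto simp: has_bochner_integral_iff)
    also have "Beta p (\<delta> + of_nat j) \<ge> 0"
      using assms by (simp add: Beta_def less_imp_le Gamma_real_pos add_pos_nonneg)
    then have "\<bar>c j\<bar> * Beta p (\<delta> + of_nat j) = \<bar>c j * Beta p (\<delta> + of_nat j)\<bar>"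
      by (simp add: abs_mult)
    finally show "(LINT x|lborel. norm (c j * B j x)) = \<bar>c j * Beta p (\<delta> + of_nat j)\<bar>" .
  qed
  have S: "(\<lambda>j. c j * B j x) sums
      (indicator {0<..<1} x * (x powr (p - 1) * (1 - x) powr (\<delta> - 1) * hyp_2F1 \<beta> \<alpha> \<delta> (1 - x)))"
    and Sn: "summable (\<lambda>j. norm (c j * B j x))" for x
  proof -
    let ?h = "\<lambda>j. pochhammer \<beta> j * pochhammer \<alpha> j / pochhammer \<delta> j * ((1 - x) ^ j / fact j)"
    let ?w = "x powr (p - 1) * (1 - x) powr (\<delta> - 1)"
    have "(\<lambda>j. c j * B j x) sums (indicator {0<..<1} x * (?w * hyp_2F1 \<beta> \<alpha> \<delta> (1 - x))) \<and>
          summable (\<lambda>j. norm (c j * B j x))"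
    proof (cases "x \<in> {0<..<1}")
      case True
      have eq: "c j * B j x = ?w * ?h j" for j
      proof -
        have "(1 - x) powr (\<delta> + real j - 1) = (1 - x) powr (\<delta> - 1) * (1 - x) ^ j"
          using True by (simp add: powr_add_of_nat_minus_1)
        then show ?thesis using True by (simp add: c_def B_def)
      qed
      have sn: "summable (\<lambda>j. \<bar>?h j\<bar>)"
        using True by (intro summable_hyp_2F1_norm) auto
      have "?h sums hyp_2F1 \<beta> \<alpha> \<delta> (1 - x)"
        unfolding hyp_2F1_def using summable_rabs_cancel[OF sn] by (rule summable_sums)
      then have "(\<lambda>j. ?w * ?h j) sums (?w * hyp_2F1 \<beta> \<alpha> \<delta> (1 - x))"
        by (rule sums_mult)
      moreover have "summable (\<lambda>j. \<bar>?w\<bar> * \<bar>?h j\<bar>)"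
        using sn by (rule summable_mult)
      ultimately show ?thesis
        using True unfolding eq real_norm_def abs_mult[of ?w] by simp
    qed (simp add: B_def)
    then show "(\<lambda>j. c j * B j x) sums (indicator {0<..<1} x * (?w * hyp_2F1 \<beta> \<alpha> \<delta> (1 - x)))"
      "summable (\<lambda>j. norm (c j * B j x))" by auto
  qed
  \<comment> \<open>After the first term, the absolute value is multiplication by the fixed sign
    \<open>s\<close>, so the convergence known from Gauss's theorem is already absolute.\<close>
  have abs: "summable (\<lambda>j. \<bar>c j * Beta p (\<delta> + of_nat j)\<bar>)"
  proof -
    define s :: real where "s = (if \<alpha> \<ge> 0 then 1 else - 1)"
    have "\<bar>c (Suc j) * Beta p (\<delta> + of_nat (Suc j))\<bar> = s * (c (Suc j) * Beta p (\<delta> + of_nat (Suc j)))" for j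
    proof -
      have "0 \<le> s * pochhammer \<alpha> (Suc j)"
        using pochhammer_sign[OF assms(1), of "Suc j"] by (simp add: s_def)
      moreover have "0 \<le> Beta p \<delta>"
        using assms by (simp add: Beta_def less_imp_le Gamma_real_pos)
      moreover have "pochhammer \<beta> (Suc j) > 0" "pochhammer (p + \<delta>) (Suc j) > 0"
        using assms by (auto intro!: pochhammer_pos)
      ultimately have "0 \<le> Beta p \<delta> * (pochhammer \<beta> (Suc j) * (s * pochhammer \<alpha> (Suc j)) / (pochhammer (p + \<delta>) (Suc j) * fact (Suc j)))"
        by (intro mult_nonneg_nonneg[of "Beta p \<delta>"] divide_nonneg_pos mult_pos_pos
              mult_nonneg_nonneg[of "pochhammer \<beta> (Suc j)"]) simp_all
      also have "\<dots> = s * (c (Suc j) * Beta p (\<delta> + of_nat (Suc j)))"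
        unfolding cB by (simp only: times_divide_eq_right mult_ac)
      finally show ?thesis
        by (auto simp: s_def split: if_splits)
    qed
    moreover have "summable (\<lambda>j. s * (c (Suc j) * Beta p (\<delta> + of_nat (Suc j))))"
      using sums_summable[OF sums] by (intro summable_mult, subst summable_Suc_iff)
    ultimately show ?thesis
      by (subst summable_Suc_iff[symmetric]) simp
  qed
  have eqf: "(\<lambda>x. indicator {0<..<1} x * (x powr (p - 1) * (1 - x) powr (\<delta> - 1) * hyp_2F1 \<beta> \<alpha> \<delta> (1 - x)))
      = (\<lambda>x. \<Sum>j. c j * B j x)"
    using S by (auto simp: fun_eq_iff sums_iff)
  have sumn: "summable (\<lambda>j. LINT x|lborel. norm (c j * B j x))"
    unfolding valn by (rule abs)
  have "integrable lborel (\<lambda>x. \<Sum>j. c j * B j x)"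
    using int Sn sumn by (intro integrable_suminf) auto
  moreover have "(LINT x|lborel. (\<Sum>j. c j * B j x)) = Beta p \<delta> * ?G"
  proof -
    have "(\<lambda>j. LINT x|lborel. c j * B j x) sums (LINT x|lborel. (\<Sum>j. c j * B j x))"
      by (rule sums_integral[OF int AE_I2[OF Sn] sumn])
    then show ?thesis
      unfolding val by (rule sums_unique2[OF _ sums])
  qed
  moreover have "Beta p \<delta> * ?G = Gamma p * Gamma \<delta> * Gamma (p + \<delta> - \<alpha> - \<beta>) / (Gamma (p + \<delta> - \<alpha>) * Gamma (p + \<delta> - \<beta>))"
  proof -
    have "Gamma (p + \<delta>) > 0" using assms by simp
    then show ?thesis by (simp add: Beta_def)
  qed
  ultimately show ?thesis
    unfolding eqf by (simp add: has_bochner_integral_iff)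
qed

text \<open>The hypothesis \<open>d > b - 1\<close>, weaker than \<open>d > b\<close>, lets the
  lemma cover the second weight too: there \<open>b\<close> becomes \<open>b + 1\<close>, and
  \<open>d > b\<close> is all that is known. This is why the Gauss series is treated for
  \<open>\<alpha> > -1\<close>.\<close>

lemma has_bochner_integral_weight_W:
  fixes a b c d :: real
  assumes "a > 0" "b > 0" "c > b" "d > b - 1" "d > 0" "c + d > a + b"
  shows "has_bochner_integral lborel (\<lambda>x. indicator {0<..<1} x * (x ^ m * weight_W a b c d x))
           (pochhammer a m * pochhammer b m / (pochhammer c m * pochhammer d m))"
proof -
  define \<delta> where "\<delta> = c + d - a - b"
  let ?C = "Gamma c * Gamma d / (Gamma a * Gamma b * Gamma \<delta>)"
  \<comment> \<open>With \<open>p = a + m\<close>, \<open>\<alpha> = d - b\<close> and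
    \<open>\<beta> = c - b\<close>, the Gamma arguments other than \<open>\<delta>\<close> collapse
    to \<open>a + m\<close>, \<open>b + m\<close>, \<open>c + m\<close> and
    \<open>d + m\<close>.\<close>
  have "has_bochner_integral lborel
    (\<lambda>x. indicator {0<..<1} x * (x powr (a + m - 1) * (1 - x) powr (\<delta> - 1) * hyp_2F1 (c - b) (d - b) \<delta> (1 - x)))
    (Gamma (a + m) * Gamma \<delta> * Gamma (a + m + \<delta> - (d - b) - (c - b)) / (Gamma (a + m + \<delta> - (d - b)) * Gamma (a + m + \<delta> - (c - b))))"
    using assms by (intro has_bochner_integral_hyp_2F1) (auto simp: \<delta>_def)
  also have "a + m + \<delta> - (d - b) - (c - b) = b + m" by (simp add: \<delta>_def)
  also have "a + m + \<delta> - (d - b) = c + m" by (simp add: \<delta>_def)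
  also have "a + m + \<delta> - (c - b) = d + m" by (simp add: \<delta>_def)
  finally have "has_bochner_integral lborel
    (\<lambda>x. ?C * (indicator {0<..<1} x * (x powr (a + m - 1) * (1 - x) powr (\<delta> - 1) * hyp_2F1 (c - b) (d - b) \<delta> (1 - x))))
    (?C * (Gamma (a + m) * Gamma \<delta> * Gamma (b + m) / (Gamma (c + m) * Gamma (d + m))))"
    by (rule has_bochner_integral_mult_right)
  moreover have "?C * (indicator {0<..<1} x * (x powr (a + m - 1) * (1 - x) powr (\<delta> - 1) * hyp_2F1 (c - b) (d - b) \<delta> (1 - x)))
     = indicator {0<..<1} x * (x ^ m * weight_W a b c d x)" for x
  proof (cases "x \<in> {0<..<1}")
    case True
    have "x powr (a + m - 1) = x powr (a - 1) * x ^ m"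
      using True by (simp add: powr_add_of_nat_minus_1)
    then show ?thesis
      using True by (simp add: weight_W_def Let_def \<delta>_def)
  qed simp
  moreover have "?C * (Gamma (a + m) * Gamma \<delta> * Gamma (b + m) / (Gamma (c + m) * Gamma (d + m)))
     = pochhammer a m * pochhammer b m / (pochhammer c m * pochhammer d m)"
  proof -
    have "Gamma \<delta> > 0" using assms by (simp add: \<delta>_def)
    then show ?thesis
      using assms by (simp add: pochhammer_Gamma_real field_simps)
  qed
  ultimately show ?thesis by simp
qed

section \<open>Finite differences and orthogonality of the \<open>3F2\<close> polynomial\<close>

text \<open>The sum is, up to sign, the \<open>n\<close>-th finite difference of \<open>p\<close> at
  0. By Pascal's rule the sum of order \<open>n + 1\<close> for \<open>p\<close> is the sum of order
  \<open>n\<close> for \<open>q(x) = p(x) - p(x + 1)\<close>, which has smaller degree.\<close>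

lemma sum_alternating_binomial_poly_eq_0:
  fixes p :: "'a::{idom} poly"
  assumes "degree p < n"
  shows "(\<Sum>j\<le>n. (-1) ^ j * of_nat (n choose j) * poly p (of_nat j)) = 0"
  using assms
proof (induction n arbitrary: p)
  case (Suc n)
  define q where "q = p - pcompose p [:1, 1:]"
  \<comment> \<open>For constant \<open>p\<close> the degree cannot drop, but then
    \<open>q = 0\<close> and its sum vanishes trivially.\<close>
  have "q = 0 \<or> degree q < degree p"
  proof (rule eq_zero_or_degree_less)
    show "degree q \<le> degree p"
      unfolding q_def by (intro degree_diff_le) (auto simp: degree_pcompose)
    have "coeff (pcompose p [:1, 1:]) (degree p) = lead_coeff p"
      using lead_coeff_comp[of "[:1, 1:]" p] by (simp add: degree_pcompose)
    then show "coeff q (degree p) = 0"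
      by (simp add: q_def)
  qed
  then have 0: "(\<Sum>j\<le>n. (-1) ^ j * of_nat (n choose j) * poly q (of_nat j)) = 0"
    using Suc by auto
  let ?t = "\<lambda>j. (-1) ^ j * of_nat (n choose j) * poly p (of_nat j)"
  let ?u = "\<lambda>j. (-1) ^ j * of_nat (n choose j) * poly p (of_nat (Suc j))"
  have Pascal: "(-1) ^ Suc j * of_nat (Suc n choose Suc j) * poly p (of_nat (Suc j)) = ?t (Suc j) - ?u j" for j
    by (simp add: ring_distribs)
  have "(\<Sum>j\<le>Suc n. (-1) ^ j * of_nat (Suc n choose j) * poly p (of_nat j))
      = poly p 0 + (\<Sum>j\<le>n. ?t (Suc j) - ?u j)"
    by (subst sum.atMost_Suc_shift) (simp only: Pascal, simp)
  also have "\<dots> = (poly p 0 + (\<Sum>j\<le>n. ?t (Suc j))) - (\<Sum>j\<le>n. ?u j)"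
    by (simp add: sum_subtractf)
  also have "poly p 0 + (\<Sum>j\<le>n. ?t (Suc j)) = (\<Sum>j\<le>Suc n. ?t j)"
    by (subst sum.atMost_Suc_shift) simp
  also have "\<dots> = (\<Sum>j\<le>n. ?t j)"
    by (simp add: binomial_eq_0)
  also have "(\<Sum>j\<le>n. ?t j) - (\<Sum>j\<le>n. ?u j) = (\<Sum>j\<le>n. (-1) ^ j * of_nat (n choose j) * poly q (of_nat j))"
    by (simp add: q_def poly_pcompose algebra_simps flip: sum_subtractf)
  finally show ?case
    using 0 by simp
qed simp

lemma pochhammer_shift_is_poly:
  fixes x :: "'a::idom"
  shows "\<exists>p. degree p \<le> k \<and> (\<forall>y. poly p y = pochhammer (x + y) k)"
proof (induction k)
  case (Suc k)
  then obtain p where p: "degree p \<le> k" "\<And>y. poly p y = pochhammer (x + y) k" by auto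
  have "degree (p * [:x + of_nat k, 1:]) \<le> Suc k"
    using degree_mult_le[of p "[:x + of_nat k, 1:]"] p by simp
  moreover have "poly (p * [:x + of_nat k, 1:]) y = pochhammer (x + y) (Suc k)" for y
    by (simp add: p pochhammer_Suc algebra_simps)
  ultimately show ?case by blast
qed (auto intro: exI[of _ 1])

text \<open>The coefficients of \<open>\<^sub>3F\<^sub>2(-n, c + \<lfloor>n/2\<rfloor>, d + \<lfloor>(n-1)/2\<rfloor>; a, b; x)\<close>, for \<open>n \<ge> 1\<close>.\<close>

definition hyp_3F2_coeff :: "real \<Rightarrow> real \<Rightarrow> real \<Rightarrow> real \<Rightarrow> nat \<Rightarrow> nat \<Rightarrow> real" where
  "hyp_3F2_coeff a b c d n j =
     pochhammer (- real n) j * pochhammer (c + real (n div 2)) j * pochhammer (d + real ((n - 1) div 2)) j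
       / (pochhammer a j * pochhammer b j * fact j)"

lemma pochhammer_minus_of_nat_over_fact:
  "pochhammer (- real n) j / fact j = (-1) ^ j * real (n choose j)"
proof -
  have "real (n choose j) = (-1) ^ j * pochhammer (- real n) j / fact j"
    by (simp add: binomial_gbinomial gbinomial_pochhammer)
  then show ?thesis
    by (cases "even j") auto
qed

text \<open>Splitting \<open>pochhammer c (m + j)\<close> after \<open>m\<close> factors and after
  \<open>l + j\<close> factors gives two products to compare. The right-hand side is a polynomial in
  \<open>j\<close> of degree \<open>m - l\<close>, although the left-hand side has a number of
  factors growing with \<open>j\<close>.\<close>

lemma pochhammer_ratio_shift:
  fixes c :: real
  assumes "c > 0" "l \<le> m"
  shows "pochhammer (c + real m) j / pochhammer c (l + j)
    = pochhammer (c + real l + real j) (m - l) / pochhammer c m"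
proof -
  have "pochhammer c m * pochhammer (c + real m) j = pochhammer c ((l + j) + (m - l))"
    using assms pochhammer_product'[of c m j] by (simp add: add.commute)
  also have "\<dots> = pochhammer c (l + j) * pochhammer (c + real l + real j) (m - l)"
    by (subst pochhammer_product') (simp add: add_ac)
  finally show ?thesis
    using assms pochhammer_pos[of c m] pochhammer_pos[of c "l + j"] by (simp add: field_simps)
qed

text \<open>
  Both Pochhammer quotients in the summand are polynomials in \<open>j\<close>, so the sum is an \<open>n\<close>-th
  difference of a polynomial of degree \<open>n div 2 + (n - 1) div 2 < n\<close>.
\<close>

lemma hyp_3F2_coeff_moment_sum_eq_0:
  fixes a b c d :: real
  assumes pos: "a > 0" "b > 0" "c > 0" "d > 0"
    and "n > 0" "l \<le> n div 2" "k \<le> (n - 1) div 2"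
  shows "(\<Sum>j\<le>n. hyp_3F2_coeff a b c d n j *
    (pochhammer a (k + j) * pochhammer b (l + j) / (pochhammer c (l + j) * pochhammer d (k + j)))) = 0"
proof -
  let ?m = "n div 2" and ?m' = "(n - 1) div 2"
  obtain pa where pa: "degree pa \<le> k" "\<And>y. poly pa y = pochhammer (a + y) k"
    using pochhammer_shift_is_poly[of k a] by blast
  obtain pb where pb: "degree pb \<le> l" "\<And>y. poly pb y = pochhammer (b + y) l"
    using pochhammer_shift_is_poly[of l b] by blast
  obtain pc where pc: "degree pc \<le> ?m - l" "\<And>y. poly pc y = pochhammer ((c + real l) + y) (?m - l)"
    using pochhammer_shift_is_poly[of "?m - l" "c + real l"] by blast
  obtain pd where pd: "degree pd \<le> ?m' - k" "\<And>y. poly pd y = pochhammer ((d + real k) + y) (?m' - k)"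
    using pochhammer_shift_is_poly[of "?m' - k" "d + real k"] by blast
  define p where "p = pa * pb * pc * pd"
  have "degree p \<le> degree pa + degree pb + degree pc + degree pd"
    unfolding p_def by (intro order.trans[OF degree_mult_le] add_mono order.refl)
  also have "\<dots> \<le> k + l + (?m - l) + (?m' - k)"
    using pa pb pc pd by (intro add_mono) auto
  also have "\<dots> = ?m + ?m'" using assms by simp
  also have "\<dots> < n" using \<open>n > 0\<close> by presburger
  finally have deg: "degree p < n" .
  have "hyp_3F2_coeff a b c d n j *
      (pochhammer a (k + j) * pochhammer b (l + j) / (pochhammer c (l + j) * pochhammer d (k + j)))
    = 1 / (pochhammer c ?m * pochhammer d ?m') * ((-1) ^ j * real (n choose j) * poly p (real j))" for j
  proof -
    have *: "pochhammer x (i + j) / pochhammer x j = pochhammer (x + real j) i" if "x > 0" for x :: real and i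
      using pochhammer_pos[OF that, of j] by (simp add: pochhammer_product' add.commute[of i])
    have "hyp_3F2_coeff a b c d n j *
        (pochhammer a (k + j) * pochhammer b (l + j) / (pochhammer c (l + j) * pochhammer d (k + j)))
      = (pochhammer (- real n) j / fact j) * (pochhammer a (k + j) / pochhammer a j)
        * (pochhammer b (l + j) / pochhammer b j)
        * (pochhammer (c + real ?m) j / pochhammer c (l + j))
        * (pochhammer (d + real ?m') j / pochhammer d (k + j))"
      by (simp add: hyp_3F2_coeff_def mult_ac)
    also have "\<dots> = ((-1) ^ j * real (n choose j)) * pochhammer (a + real j) k * pochhammer (b + real j) l
        * (pochhammer (c + real l + real j) (?m - l) / pochhammer c ?m)
        * (pochhammer (d + real k + real j) (?m' - k) / pochhammer d ?m')"
      using assms by (simp only: * pochhammer_minus_of_nat_over_fact pochhammer_ratio_shift)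
    also have "\<dots> = 1 / (pochhammer c ?m * pochhammer d ?m') * ((-1) ^ j * real (n choose j) * poly p (real j))"
      by (simp add: p_def pa pb pc pd)
    finally show ?thesis .
  qed
  then show ?thesis
    using sum_alternating_binomial_poly_eq_0[OF deg] by (simp only: sum_distrib_left[symmetric] mult_zero_right)
qed

section \<open>Identification of \<open>P n\<close> from the orthogonality conditions\<close>

text \<open>Integration is linear, so only the moments enter. The bound \<open>N\<close> is left
  free so that polynomials of different degrees can share one summation range, as additivity of the
  functionals requires.\<close>

lemma LINT_power_poly_weight:
  fixes w :: "real \<Rightarrow> real" and p :: "complex poly"
  assumes \<mu>: "\<And>m. has_bochner_integral lborel (\<lambda>x. indicator {0<..<1} x * (x ^ m * w x)) (\<mu> m)"
    and N: "degree p \<le> N"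
  shows "(LINT x:{0<..<1}|lborel.
      complex_of_real x ^ k * poly p (complex_of_real x) * complex_of_real (w x))
    = (\<Sum>i\<le>N. coeff p i * complex_of_real (\<mu> (k + i)))"
proof -
  have poly: "poly p x = (\<Sum>i\<le>N. coeff p i * x ^ i)" for x
    unfolding poly_altdef using N
    by (intro sum.mono_neutral_left) (auto simp: coeff_eq_0)
  have "has_bochner_integral lborel
      (\<lambda>x. \<Sum>i\<le>N. coeff p i * complex_of_real (indicator {0<..<1} x * (x ^ (k + i) * w x)))
      (\<Sum>i\<le>N. coeff p i * complex_of_real (\<mu> (k + i)))"
    by (intro has_bochner_integral_sum has_bochner_integral_mult_right has_bochner_integral_of_real \<mu>)
  moreover have "(\<Sum>i\<le>N. coeff p i * complex_of_real (indicator {0<..<1} x * (x ^ (k + i) * w x)))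
     = indicator {0<..<1} x *\<^sub>R (complex_of_real x ^ k * poly p (complex_of_real x) * complex_of_real (w x))" for x
    by (cases "x \<in> {0<..<1}") (simp_all add: poly power_add sum_distrib_left sum_distrib_right mult_ac)
  ultimately show ?thesis
    unfolding set_lebesgue_integral_def by (simp add: has_bochner_integral_integral_eq)
qed

lemma poly_expansion_in_monic_basis:
  fixes P :: "nat \<Rightarrow> 'a::comm_ring_1 poly"
  assumes P: "\<And>n. degree (P n) = n" "\<And>n. lead_coeff (P n) = 1"
  shows "degree D < n \<Longrightarrow> \<exists>e. D = (\<Sum>i<n. smult (e i) (P i))"
proof (induction n arbitrary: D)
  case (Suc n)
  define D' where "D' = D - smult (coeff D n) (P n)"
  have "degree (smult (coeff D n) (P n)) \<le> n"
    using degree_smult_le[of "coeff D n" "P n"] P(1) by simp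
  then have deg: "degree D' \<le> n"
    unfolding D'_def using Suc.prems by (intro degree_diff_le) auto
  have "coeff D' n = 0"
    using P[of n] by (simp add: D'_def)
  with deg have "D' = 0 \<or> degree D' < n"
    by (rule eq_zero_or_degree_less)
  then obtain e where e: "D' = (\<Sum>i<n. smult (e i) (P i))"
  \<comment> \<open>The zero remainder is handled separately: for \<open>n = 0\<close> it cannot
    satisfy \<open>degree D' < n\<close>, so the induction hypothesis would not apply.\<close>
  proof
    assume "D' = 0"
    then show thesis using that[of "\<lambda>_. 0"] by simp
  qed (use Suc.IH in blast)
  have "D = (\<Sum>i<Suc n. smult ((e(n := coeff D n)) i) (P i))"
    using e by (simp add: D'_def algebra_simps)
  then show ?case by blast
qed simp

text \<open>The matrix \<open>u i (P l)\<close> is triangular with nonzero diagonal. Applying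
  \<open>u i\<close> to the expansion of \<open>D\<close> kills the terms \<open>l > i\<close> by
  orthogonality and \<open>l < i\<close> by induction, which leaves
  \<open>e i * u i (P i) = 0\<close>.\<close>

lemma eq_0_if_triangular_functionals_vanish:
  fixes P :: "nat \<Rightarrow> 'a::idom poly" and u :: "nat \<Rightarrow> 'a poly \<Rightarrow> 'a"
  assumes P: "\<And>n. degree (P n) = n" "\<And>n. lead_coeff (P n) = 1"
    and lin: "\<And>i p q. u i (p + q) = u i p + u i q" "\<And>i s p. u i (smult s p) = s * u i p"
    and orth: "\<And>i n. i < n \<Longrightarrow> u i (P n) = 0" "\<And>n. u n (P n) \<noteq> 0"
    and D: "degree D < n" "\<And>i. i < n \<Longrightarrow> u i D = 0"
  shows "D = 0"
proof -
  obtain e where e: "D = (\<Sum>i<n. smult (e i) (P i))"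
    using poly_expansion_in_monic_basis[OF P D(1)] by blast
  have u0: "u i 0 = 0" for i
    using lin(2)[of i 0 0] by simp
  have usum: "u i (\<Sum>l\<in>S. smult (e l) (P l)) = (\<Sum>l\<in>S. e l * u i (P l))" if "finite S" for i S
    using that by (induction S) (auto simp: lin u0)
  have "i < n \<Longrightarrow> e i = 0" for i
  proof (induction i rule: less_induct)
    case (less i)
    have "0 = (\<Sum>l<n. e l * u i (P l))"
      using D(2)[OF less.prems] usum[of "{..<n}" i] by (simp add: e)
    also have "\<dots> = (\<Sum>l\<in>{i}. e l * u i (P l))"
    proof (rule sum.mono_neutral_right)
      show "\<forall>l\<in>{..<n} - {i}. e l * u i (P l) = 0"
      proof
        fix l assume "l \<in> {..<n} - {i}"
        then consider "l < i" "l < n" | "i < l" by force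
        then show "e l * u i (P l) = 0"
          by cases (auto simp: less.IH orth(1))
      qed
    qed (use less.prems in auto)
    finally show ?case using orth(2)[of i] by simp
  qed
  then show ?thesis by (simp add: e)
qed

text \<open>Both sides have the same coefficient at \<open>n\<close>, so their difference has degree
  below \<open>n\<close> or is 0, and the first \<open>n\<close> orthogonality functionals
  annihilate it. Scaling \<open>P n\<close> instead of normalising the \<open>3F2\<close> polynomial
  avoids a division and produces exactly the prefactor of the limit.\<close>

lemma monic_2_orthogonal_explicit:
  fixes a b c d :: real and P :: "nat \<Rightarrow> complex poly"
  assumes pos: "a > 0" "b > 0" "c > 0" "d > 0"
    and "c > b" "d > b" "c + d > a + b"
    and P: "monic_2_orthogonal (weight_vec a b c d) P"
    and "n > 0"
  shows "smult (complex_of_real (hyp_3F2_coeff a b c d n n)) (P n)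
    = (\<Sum>j\<le>n. monom (complex_of_real (hyp_3F2_coeff a b c d n j)) j)" (is "smult ?\<kappa> _ = ?R")
proof -
  define \<mu> where "\<mu> = (\<lambda>j m. if j = (0::nat)
    then pochhammer a m * pochhammer b m / (pochhammer c m * pochhammer d m)
    else pochhammer a m * pochhammer (b + 1) m / (pochhammer (c + 1) m * pochhammer d m))"
  have \<mu>: "has_bochner_integral lborel (\<lambda>x. indicator {0<..<1} x * (x ^ m * weight_vec a b c d j x)) (\<mu> j m)" for j m
    using has_bochner_integral_weight_W[of a b c d m] has_bochner_integral_weight_W[of a "b + 1" "c + 1" d m]
      assms by (cases "j = 0") (simp_all add: weight_vec_def \<mu>_def)
  \<comment> \<open>The two families are interleaved: \<open>i = 2 * k + j\<close> stands for
    integration of \<open>x ^ k\<close> against the weight of index \<open>j\<close>. The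
    orthogonality conditions then read \<open>i < n\<close> for vanishing and \<open>i = n\<close>
    for nonvanishing.\<close>
  define u where "u = (\<lambda>i p. LINT x:{0<..<1}|lborel. complex_of_real x ^ (i div 2) *
     poly p (complex_of_real x) * complex_of_real (weight_vec a b c d (i mod 2) x))"
  have u: "u i p = (\<Sum>l\<le>N. coeff p l * complex_of_real (\<mu> (i mod 2) (i div 2 + l)))" if "degree p \<le> N" for i p N
    unfolding u_def using LINT_power_poly_weight[OF \<mu> that] .
  have degP: "degree (P n) = n" and leadP: "lead_coeff (P n) = 1" for n
    using P unfolding monic_2_orthogonal_def by blast+
  have mod2: "i mod 2 \<in> {0, 1}" for i :: nat
    by auto
  note P' = P[unfolded monic_2_orthogonal_def Let_def, THEN conjunct2, THEN bspec, OF mod2,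
      THEN spec, THEN spec]
  have D: "smult ?\<kappa> (P n) - ?R = 0"
  proof (cases "smult ?\<kappa> (P n) - ?R = 0")
    case False
    have degR: "degree ?R \<le> n"
      by (intro degree_sum_le) (auto intro: order.trans[OF degree_monom_le])
    have coeffR: "coeff ?R l = (if l \<le> n then complex_of_real (hyp_3F2_coeff a b c d n l) else 0)" for l
      by (simp add: coeff_sum)
    have degD: "degree (smult ?\<kappa> (P n) - ?R) < n"
    proof -
      have "degree (smult ?\<kappa> (P n) - ?R) \<le> n"
        using degR degP by (intro degree_diff_le) (auto intro: order.trans[OF degree_smult_le])
      moreover have "coeff (smult ?\<kappa> (P n) - ?R) n = 0"
        using leadP[of n] by (simp add: degP coeffR)
      ultimately show ?thesis
        using eq_zero_or_degree_less False by blast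
    qed
    have add: "u i (p + q) = u i p + u i q" for i p q
      by (simp add: u[of _ "max (degree p) (degree q)"] degree_add_le_max sum.distrib algebra_simps)
    have smult: "u i (smult s p) = s * u i p" for i s p
      by (simp add: u[of _ "degree p"] degree_smult_le sum_distrib_left mult_ac)
    have orth: "u i (P m) = 0" if "i < m" for i m
      unfolding u_def by (rule P'[THEN conjunct1, THEN mp]) (use that in simp)
    have nz: "u m (P m) \<noteq> 0" for m
      unfolding u_def by (rule P'[THEN conjunct2, THEN mp]) simp
    have uR: "u i ?R = 0" if "i < n" for i
    proof -
      define k where "k = i div 2"
      have "u i ?R = complex_of_real (\<Sum>l\<le>n. hyp_3F2_coeff a b c d n l * \<mu> (i mod 2) (k + l))"
        by (simp add: u[OF degR] coeffR k_def)
      also have "(\<Sum>l\<le>n. hyp_3F2_coeff a b c d n l * \<mu> (i mod 2) (k + l)) = 0"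
      proof (cases "i mod 2 = 0")
        case True
        \<comment> \<open>For even \<open>i = 2 * k < n\<close> the first weight is in force, and
          the moment sum is the case \<open>l = k\<close>.\<close>
        then have "k \<le> n div 2" "k \<le> (n - 1) div 2"
          using that unfolding k_def by presburger+
        then show ?thesis
          using hyp_3F2_coeff_moment_sum_eq_0[OF pos \<open>n > 0\<close>, of k k] True by (simp add: \<mu>_def)
      next
        case False
        \<comment> \<open>For odd \<open>i = 2 * k + 1 < n\<close> the shifts \<open>b + 1\<close>
          and \<open>c + 1\<close> raise the Pochhammer index by one, so \<open>l = k + 1\<close>;
          the leading factors \<open>b\<close> and \<open>c\<close> leave the constant
          \<open>c / b\<close>.\<close>
        then have "Suc k \<le> n div 2" "k \<le> (n - 1) div 2"
          using that unfolding k_def by presburger+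
        then have 0: "(\<Sum>j\<le>n. hyp_3F2_coeff a b c d n j * (pochhammer a (k + j) * pochhammer b (Suc k + j)
            / (pochhammer c (Suc k + j) * pochhammer d (k + j)))) = 0"
          by (rule hyp_3F2_coeff_moment_sum_eq_0[OF pos \<open>n > 0\<close>])
        have "\<mu> (i mod 2) (k + j) = c / b * (pochhammer a (k + j) * pochhammer b (Suc k + j)
            / (pochhammer c (Suc k + j) * pochhammer d (k + j)))" for j
          using False pos by (simp add: \<mu>_def pochhammer_rec)
        then have "(\<Sum>l\<le>n. hyp_3F2_coeff a b c d n l * \<mu> (i mod 2) (k + l))
          = c / b * (\<Sum>j\<le>n. hyp_3F2_coeff a b c d n j * (pochhammer a (k + j) * pochhammer b (Suc k + j)
            / (pochhammer c (Suc k + j) * pochhammer d (k + j))))"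
          by (simp only: sum_distrib_left mult.left_commute)
        then show ?thesis unfolding 0 by simp
      qed
      finally show ?thesis by simp
    qed
    have "u i (smult ?\<kappa> (P n) - ?R) = 0" if "i < n" for i
      \<comment> \<open>Subtraction is presented as adding \<open>smult (-1)\<close>, since only
        additivity and homogeneity of \<open>u\<close> are at hand; simplification of that scalar is
        blocked until homogeneity has been used.\<close>
      using add[of i "smult ?\<kappa> (P n)" "smult (-1) ?R"] that
      by (simp add: smult orth uR del: smult_minus_left smult_1_left) simp
    then show ?thesis
      using eq_0_if_triangular_functionals_vanish[of P u, OF degP leadP add smult orth nz degD] by blast
  qed simp
  then show ?thesis by simp
qed

section \<open>Asymptotics and uniform bounds of the scaled coefficients\<close>

lemma tendsto_pochhammer_over_power:
  fixes x L :: real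
  assumes "(\<lambda>n. f n / real n) \<longlonglongrightarrow> L"
  shows "(\<lambda>n. pochhammer (x + f n) j / real n ^ j) \<longlonglongrightarrow> L ^ j"
proof (induction j)
  case (Suc j)
  have "(\<lambda>n. (x + real j) / real n) \<longlonglongrightarrow> 0"
    by real_asymp
  then have "(\<lambda>n. pochhammer (x + f n) j / real n ^ j * ((x + real j) / real n + f n / real n)) \<longlonglongrightarrow> L ^ j * (0 + L)"
    by (intro tendsto_intros Suc assms)
  moreover have "pochhammer (x + f n) j / real n ^ j * ((x + real j) / real n + f n / real n)
     = pochhammer (x + f n) (Suc j) / real n ^ Suc j" for n
    by (simp add: pochhammer_Suc add_divide_distrib[symmetric] algebra_simps)
  ultimately show ?case by (simp add: mult.commute)
qed simp

lemma abs_pochhammer_le_power: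
  fixes x :: real
  assumes "\<And>i. i < j \<Longrightarrow> \<bar>x + real i\<bar> \<le> B"
  shows "\<bar>pochhammer x j\<bar> \<le> B ^ j"
  using assms
proof (induction j)
  case (Suc j)
  have "\<bar>pochhammer x j\<bar> * \<bar>x + real j\<bar> \<le> B ^ j * B"
    using Suc.prems[of j] by (intro mult_mono Suc) (auto intro: order.trans[OF abs_ge_zero Suc.prems[of 0]] zero_le_power)
  then show ?case by (simp add: pochhammer_Suc abs_mult mult.commute)
qed simp

text \<open>The ratios of consecutive terms decay like \<open>1 / j ^ 3\<close>. This serves both
  the convergence of the \<open>0F2\<close> series and the majorant in Tannery's theorem.\<close>

lemma summable_0F2_coeff:
  fixes a b K :: real
  shows "summable (\<lambda>j. K ^ j / (pochhammer a j * pochhammer b j * fact j))"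
proof -
  have "(\<lambda>j. \<bar>K / ((a + real j) * (b + real j) * (1 + real j))\<bar>) \<longlonglongrightarrow> 0"
    by (rule tendsto_rabs_zero) real_asymp
  then have "eventually (\<lambda>j. \<bar>K / ((a + real j) * (b + real j) * (1 + real j))\<bar> < 1/2) sequentially"
    by (rule order_tendstoD) simp
  then obtain N where N: "\<And>j. j \<ge> N \<Longrightarrow> \<bar>K / ((a + real j) * (b + real j) * (1 + real j))\<bar> \<le> 1/2"
    by (auto simp: eventually_sequentially intro: less_imp_le)
  show ?thesis
  proof (rule summable_ratio_test[where c = "1/2" and N = N])
    fix j assume "j \<ge> N"
    have "norm (K ^ Suc j / (pochhammer a (Suc j) * pochhammer b (Suc j) * fact (Suc j)))
      = \<bar>K / ((a + real j) * (b + real j) * (1 + real j))\<bar> * norm (K ^ j / (pochhammer a j * pochhammer b j * fact j))"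
      by (simp add: pochhammer_Suc abs_mult mult_ac)
    also have "\<dots> \<le> 1/2 * norm (K ^ j / (pochhammer a j * pochhammer b j * fact j))"
      using N[OF \<open>j \<ge> N\<close>] by (intro mult_right_mono) auto
    finally show "norm (K ^ Suc j / (pochhammer a (Suc j) * pochhammer b (Suc j) * fact (Suc j)))
      \<le> 1/2 * norm (K ^ j / (pochhammer a j * pochhammer b j * fact j))" .
  qed simp
qed

lemma tendsto_hyp_3F2_coeff:
  fixes a b c d :: real
  shows "(\<lambda>n. hyp_3F2_coeff a b c d n j / real n ^ (3 * j))
    \<longlonglongrightarrow> (-1/4) ^ j / (pochhammer a j * pochhammer b j * fact j)"
proof -
  have half: "(\<lambda>n. real (n div 2) / real n) \<longlonglongrightarrow> 1/2"
    "(\<lambda>n. real ((n - 1) div 2) / real n) \<longlonglongrightarrow> 1/2"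
  proof -
    \<comment> \<open>Both floors lie between \<open>n / 2 - 1\<close> and
      \<open>n / 2\<close>.\<close>
    have l: "(\<lambda>n. (real n / 2 - 1) / real n) \<longlonglongrightarrow> 1/2" and r: "(\<lambda>n. (real n / 2) / real n) \<longlonglongrightarrow> 1/2"
      by real_asymp+
    show "(\<lambda>n. real (n div 2) / real n) \<longlonglongrightarrow> 1/2"
      by (rule tendsto_sandwich[OF _ _ l r]) (auto intro!: always_eventually divide_right_mono)
    show "(\<lambda>n. real ((n - 1) div 2) / real n) \<longlonglongrightarrow> 1/2"
      by (rule tendsto_sandwich[OF _ _ l r]) (auto intro!: always_eventually divide_right_mono)
  qed
  have "(\<lambda>n. - real n / real n) \<longlonglongrightarrow> -1"
    by real_asymp
  \<comment> \<open>The power \<open>n ^ (3 * j)\<close> is shared equally among three Pochhammer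
    symbols, with limits -1, 1/2 and 1/2 per factor; their product is the -1/4 of the
    theorem.\<close>
  then have "(\<lambda>n. pochhammer (0 + - real n) j / real n ^ j
      * (pochhammer (c + real (n div 2)) j / real n ^ j)
      * (pochhammer (d + real ((n - 1) div 2)) j / real n ^ j) / (pochhammer a j * pochhammer b j * fact j))
    \<longlonglongrightarrow> (-1) ^ j * (1/2) ^ j * (1/2) ^ j / (pochhammer a j * pochhammer b j * fact j)"
    unfolding divide_inverse[of _ "pochhammer a j * pochhammer b j * fact j"]
    by (intro tendsto_mult tendsto_const tendsto_pochhammer_over_power half)
  also have "(\<lambda>n. pochhammer (0 + - real n) j / real n ^ j
      * (pochhammer (c + real (n div 2)) j / real n ^ j)
      * (pochhammer (d + real ((n - 1) div 2)) j / real n ^ j) / (pochhammer a j * pochhammer b j * fact j))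
    = (\<lambda>n. hyp_3F2_coeff a b c d n j / real n ^ (3 * j))"
    by (simp add: fun_eq_iff hyp_3F2_coeff_def power_add mult_ac numeral_3_eq_3)
  also have "(-1) ^ j * (1/2) ^ j * (1/2) ^ j = (-1/4 :: real) ^ j"
    by (simp flip: power_mult_distrib)
  finally show ?thesis .
qed

lemma hyp_3F2_coeff_eq_0: "n < j \<Longrightarrow> hyp_3F2_coeff a b c d n j = 0"
  by (simp add: hyp_3F2_coeff_def pochhammer_of_nat_eq_0_lemma)

text \<open>For \<open>j \<le> n\<close> each factor of \<open>pochhammer (- real n) j\<close> is at
  most \<open>n\<close> in absolute value, and each factor \<open>e + m + i\<close> with
  \<open>m \<le> n\<close> is at most \<open>(e + 2) * n\<close>. The powers of \<open>n\<close>
  cancel exactly, so the bound does not depend on \<open>n\<close>; for \<open>j > n\<close> the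
  coefficient is 0.\<close>

lemma abs_hyp_3F2_coeff_le:
  fixes a b c d :: real
  assumes "a > 0" "b > 0" "c > 0" "d > 0" "n > 0"
  shows "\<bar>hyp_3F2_coeff a b c d n j / real n ^ (3 * j)\<bar>
    \<le> ((c + 2) * (d + 2)) ^ j / (pochhammer a j * pochhammer b j * fact j)"
proof (cases "j \<le> n")
  case True
  have pab: "pochhammer a j > 0" "pochhammer b j > 0"
    using assms by (auto intro: pochhammer_pos)
  have B: "\<bar>pochhammer (e + real m) j\<bar> \<le> ((e + 2) * real n) ^ j" if "e > 0" "m \<le> n" for e m
  proof (rule abs_pochhammer_le_power)
    fix i assume "i < j"
    then have "real i \<le> real n" "real m \<le> real n" and "1 \<le> real n"
      using True that assms by auto
    moreover have "e \<le> e * real n"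
      using \<open>1 \<le> real n\<close> \<open>e > 0\<close> by simp
    ultimately have "e + real m + real i \<le> e * real n + 2 * real n"
      by linarith
    then show "\<bar>e + real m + real i\<bar> \<le> (e + 2) * real n"
      using that by (simp add: algebra_simps)
  qed
  have "\<bar>hyp_3F2_coeff a b c d n j\<bar> = \<bar>pochhammer (- real n) j\<bar> * \<bar>pochhammer (c + real (n div 2)) j\<bar>
      * \<bar>pochhammer (d + real ((n - 1) div 2)) j\<bar> / (pochhammer a j * pochhammer b j * fact j)"
    using pab by (simp add: hyp_3F2_coeff_def abs_mult)
  also have "\<dots> \<le> real n ^ j * ((c + 2) * real n) ^ j * ((d + 2) * real n) ^ j / (pochhammer a j * pochhammer b j * fact j)"
    using assms True pab
    by (intro divide_right_mono mult_mono B abs_pochhammer_le_power) (auto intro!: zero_le_power)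
  also have "\<dots> = ((c + 2) * (d + 2)) ^ j / (pochhammer a j * pochhammer b j * fact j) * real n ^ (3 * j)"
    by (simp add: power_mult_distrib power_add numeral_3_eq_3 mult_ac)
  finally show ?thesis
    using assms by (simp add: abs_mult pos_divide_le_eq)
next
  case False
  have "pochhammer a j > 0" "pochhammer b j > 0"
    using assms by (auto intro: pochhammer_pos)
  with False show ?thesis
    using assms by (simp add: hyp_3F2_coeff_eq_0)
qed

text \<open>Tannery's theorem is applied to absolute differences weighted by \<open>R ^ j\<close>,
  not to the series at a point \<open>z\<close>. The result is one null sequence that controls all
  \<open>z\<close> with \<open>norm z \<le> R\<close>, which is where uniformity comes from.\<close>

lemma tendsto_suminf_abs_hyp_3F2_coeff_diff:
  fixes a b c d R :: real
  assumes pos: "a > 0" "b > 0" "c > 0" "d > 0" and "R \<ge> 0"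
  shows "(\<lambda>n. \<Sum>j. \<bar>hyp_3F2_coeff a b c d n j / real n ^ (3 * j)
      - (-1/4) ^ j / (pochhammer a j * pochhammer b j * fact j)\<bar> * R ^ j) \<longlonglongrightarrow> 0" (is "(\<lambda>n. \<Sum>j. ?g j n) \<longlonglongrightarrow> 0")
    and "n > 0 \<Longrightarrow> summable (\<lambda>j. \<bar>hyp_3F2_coeff a b c d n j / real n ^ (3 * j)
      - (-1/4) ^ j / (pochhammer a j * pochhammer b j * fact j)\<bar> * R ^ j)"
proof -
  \<comment> \<open>The factor 2 accounts for the coefficient and its limit, both under the same
    bound because \<open>1/4 \<le> 1 \<le> (c + 2) * (d + 2)\<close>.\<close>
  define M where "M = (\<lambda>j. 2 * (((c + 2) * (d + 2) * R) ^ j / (pochhammer a j * pochhammer b j * fact j)))"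
  have M: "summable M"
    unfolding M_def by (intro summable_mult summable_0F2_coeff)
  have bound: "norm (?g j n) \<le> M j" if "n > 0" for j n
  proof -
    have pab: "pochhammer a j > 0" "pochhammer b j > 0"
      using pos by (auto intro: pochhammer_pos)
    let ?B = "((c + 2) * (d + 2)) ^ j / (pochhammer a j * pochhammer b j * fact j)"
    have "1 \<le> (c + 2) * (d + 2)"
      using mult_mono[of 1 "c + 2" 1 "d + 2"] pos by simp
    then have "\<bar>(-1/4) ^ j / (pochhammer a j * pochhammer b j * fact j)\<bar> \<le> ?B"
      using pab by (auto simp: power_abs abs_mult intro!: divide_right_mono power_mono)
    then have "\<bar>hyp_3F2_coeff a b c d n j / real n ^ (3 * j)
      - (-1/4) ^ j / (pochhammer a j * pochhammer b j * fact j)\<bar> \<le> ?B + ?B"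
      by (intro order.trans[OF abs_triangle_ineq4] add_mono abs_hyp_3F2_coeff_le pos that)
    then have "?g j n \<le> (?B + ?B) * R ^ j"
      using \<open>R \<ge> 0\<close> by (intro mult_right_mono) auto
    also have "\<dots> = M j"
      by (simp add: M_def power_mult_distrib mult_ac)
    finally show ?thesis
      using \<open>R \<ge> 0\<close> by simp
  qed
  show "summable (\<lambda>j. ?g j n)" if "n > 0" for n
    using M bound[OF that] by (rule summable_comparison_test')
  have "(\<lambda>n. \<Sum>j. ?g j n) \<longlonglongrightarrow> (\<Sum>j::nat. 0)"
  proof (rule tannerys_theorem[THEN conjunct2, THEN conjunct2])
    show "(\<lambda>n. ?g j n) \<longlonglongrightarrow> 0" for j
      using tendsto_hyp_3F2_coeff[of a b c d j]
      by (intro tendsto_mult_left_zero tendsto_rabs_zero) (rule LIM_zero)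
    show "\<forall>\<^sub>F (j, n) in sequentially \<times>\<^sub>F sequentially. norm (?g j n) \<le> M j"
      unfolding eventually_prod_filter
      using bound by (intro exI[of _ "\<lambda>_. True"] exI[of _ "\<lambda>n. n > 0"]) (auto simp: eventually_gt_at_top)
  qed (use M in auto)
  then show "(\<lambda>n. \<Sum>j. ?g j n) \<longlonglongrightarrow> 0" by simp
qed

section \<open>Uniform convergence on compact sets\<close>

theorem mainTheorem10:
  fixes a b c d :: real and P :: "nat \<Rightarrow> complex poly"
  assumes "a > 0" "b > 0" "c > 0" "d > 0"
    and "min c d > max a b"
    and "monic_2_orthogonal (weight_vec a b c d) P"
  shows "\<forall>K. compact K \<longrightarrow>
    uniform_limit K
      (\<lambda>n z. complex_of_real
               ((-1) ^ n * pochhammer (c + of_int \<lfloor>real n / 2\<rfloor>) n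
                 * pochhammer (d + of_int \<lfloor>(real n - 1) / 2\<rfloor>) n
                 / (pochhammer a n * pochhammer b n))
             * poly (P n) (z / of_nat n ^ 3))
      (\<lambda>z. hyp_0F2 (complex_of_real a) (complex_of_real b) (- z / 4))
      sequentially"
proof (intro allI impI)
  fix K :: "complex set" assume "compact K"
  then obtain R where R: "R > 0" "\<And>z. z \<in> K \<Longrightarrow> norm z \<le> R"
    using compact_imp_bounded bounded_pos by metis
  define s where "s = (\<lambda>n j. hyp_3F2_coeff a b c d n j / real n ^ (3 * j))"
  define t where "t = (\<lambda>j. (-1/4) ^ j / (pochhammer a j * pochhammer b j * fact j))"
  define e where "e = (\<lambda>n. \<Sum>j. \<bar>s n j - t j\<bar> * R ^ j)"
  have e: "e \<longlonglongrightarrow> 0" and es: "\<And>n. n > 0 \<Longrightarrow> summable (\<lambda>j. \<bar>s n j - t j\<bar> * R ^ j)"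
    unfolding e_def s_def t_def
    using tendsto_suminf_abs_hyp_3F2_coeff_diff[OF assms(1-4), of R] R by auto
  let ?L = "\<lambda>n z. complex_of_real
               ((-1) ^ n * pochhammer (c + of_int \<lfloor>real n / 2\<rfloor>) n
                 * pochhammer (d + of_int \<lfloor>(real n - 1) / 2\<rfloor>) n
                 / (pochhammer a n * pochhammer b n))
             * poly (P n) (z / of_nat n ^ 3)"
  have L: "(\<lambda>j. complex_of_real (s n j) * z ^ j) sums ?L n z" if "n > 0" for n z
  proof -
    \<comment> \<open>The real floors agree with truncated division only for \<open>n > 0\<close>:
      at 0 the floor of -1/2 is -1, while \<open>(0 - 1) div 2 = 0\<close> in the naturals. The
      limit sees only positive \<open>n\<close>.\<close>
    have "\<lfloor>real n / 2\<rfloor> = int (n div 2)"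
      using floor_divide_of_nat_eq[of n 2] by simp
    moreover have "\<lfloor>(real n - 1) / 2\<rfloor> = int ((n - 1) div 2)"
      using floor_divide_of_nat_eq[of "n - 1" 2] that by (simp add: of_nat_diff)
    \<comment> \<open>Since \<open>pochhammer (- real n) n = (-1) ^ n * fact n\<close>, the
      prefactor is exactly the top \<open>3F2\<close> coefficient.\<close>
    ultimately have "?L n z = poly (smult (complex_of_real (hyp_3F2_coeff a b c d n n)) (P n)) (z / of_nat n ^ 3)"
      by (simp add: hyp_3F2_coeff_def pochhammer_same)
    also have "\<dots> = (\<Sum>j\<le>n. complex_of_real (hyp_3F2_coeff a b c d n j) * (z / of_nat n ^ 3) ^ j)"
      using assms that by (subst monic_2_orthogonal_explicit) (auto simp: poly_sum poly_monom)
    also have "\<dots> = (\<Sum>j\<le>n. complex_of_real (s n j) * z ^ j)"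
      by (simp add: s_def power_divide flip: power_mult)
    \<comment> \<open>Coefficients beyond \<open>n\<close> vanish, so the polynomial is also an
      infinite series and can be subtracted termwise from the \<open>0F2\<close> series.\<close>
    finally show ?thesis
      using sums_finite[of "{..n}" "\<lambda>j. complex_of_real (s n j) * z ^ j"]
      by (simp add: s_def hyp_3F2_coeff_eq_0)
  qed
  have H: "(\<lambda>j. complex_of_real (t j) * z ^ j) sums hyp_0F2 (complex_of_real a) (complex_of_real b) (- z / 4)" for z
  proof -
    have eq: "complex_of_real (t j) * z ^ j = 1 / (pochhammer (complex_of_real a) j * pochhammer (complex_of_real b) j)
        * ((- z / 4) ^ j / fact j)" for j
      by (cases "even j") (simp_all add: t_def power_divide pochhammer_of_real)
    have "summable (\<lambda>j. norm (complex_of_real (t j) * z ^ j))"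
    proof -
      have "norm (complex_of_real (t j) * z ^ j) = (norm z / 4) ^ j / (pochhammer a j * pochhammer b j * fact j)" for j
        using pochhammer_pos[OF assms(1), of j] pochhammer_pos[OF assms(2), of j]
        by (simp add: t_def norm_mult norm_power norm_divide power_divide)
      then show ?thesis
        by (simp only: summable_0F2_coeff)
    qed
    then have "summable (\<lambda>j. complex_of_real (t j) * z ^ j)"
      by (rule summable_norm_cancel)
    then show ?thesis
      unfolding hyp_0F2_def eq by (rule summable_sums)
  qed
  have bound: "dist (?L n z) (hyp_0F2 (complex_of_real a) (complex_of_real b) (- z / 4)) \<le> e n"
    if "n > 0" "z \<in> K" for n z
  proof -
    let ?d = "\<lambda>j. complex_of_real (s n j) * z ^ j - complex_of_real (t j) * z ^ j"
    have le: "norm (?d j) \<le> \<bar>s n j - t j\<bar> * R ^ j" for j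
    proof -
      have "norm (?d j) = \<bar>s n j - t j\<bar> * norm z ^ j"
        by (simp add: norm_mult norm_power flip: left_diff_distrib of_real_diff)
      then show ?thesis
        using R(2)[OF that(2)] by (auto intro!: mult_left_mono power_mono)
    qed
    have "?d sums (?L n z - hyp_0F2 (complex_of_real a) (complex_of_real b) (- z / 4))"
      by (intro sums_diff L H that)
    then have "dist (?L n z) (hyp_0F2 (complex_of_real a) (complex_of_real b) (- z / 4)) = norm (suminf ?d)"
      by (simp add: dist_norm sums_iff)
    also have "\<dots> \<le> e n"
      unfolding e_def by (rule norm_suminf_le[OF le es[OF that(1)]])
    finally show ?thesis .
  qed
  show "uniform_limit K ?L (\<lambda>z. hyp_0F2 (complex_of_real a) (complex_of_real b) (- z / 4)) sequentially"
  proof (rule uniform_limitI)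
    fix \<epsilon> :: real assume "\<epsilon> > 0"
    with e have "eventually (\<lambda>n. e n < \<epsilon>) sequentially"
      by (rule order_tendstoD)
    with eventually_gt_at_top[of 0]
    show "\<forall>\<^sub>F n in sequentially. \<forall>z\<in>K. dist (?L n z) (hyp_0F2 (complex_of_real a) (complex_of_real b) (- z / 4)) < \<epsilon>"
      by eventually_elim (use bound in \<open>blast intro: le_less_trans\<close>)
  qed
qed

end
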